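(* Let $M$ be the graph obtained from $H$ by contracting each of its six triangles to a single vertex. Then $M$ is the loopless cubic multigraph on the six vertices $A_1,B_1,C_1,A_2,B_2,C_2$ whose edges are, for each $i\in\{1,2\}$, a single edge $A_iB_i$, a single edge $A_iC_i$, and a double edge (two parallel edges) $B_iC_i$, together with the single edge $A_1A_2$; and $H=T(M)$.
   Context: The graph $Q$: nine vertices $a_0,a_1,a_2,b_0,b_1,b_2,c_0,c_1,c_2$; its edges are those of the three vertex-disjoint triangles $A=a_0a_1a_2$, $B=b_0b_1b_2$, $C=c_0c_1c_2$ together with the four connecting edges $a_0b_0$, $a_1c_0$, $b_1c_1$, $b_2c_2$. The vertex $a_2$ has degree $2$ and all others degree $3$. The graph $H$: take two disjoint copies $Q_1,Q_2$ of $Q$, with corresponding degree-$2$ vertices $a_2^{(1)}$ and $a_2^{(2)}$, and add the single edge $a_2^{(1)}a_2^{(2)}$. Its six triangles are the copies of $A,B,C$ in $Q_1$ and in $Q_2$; $A_i,B_i,C_i$ denote the vertices resulting from contracting the triangles $A,B,C$ of $Q_i$. In the contraction the three edges of each contracted triangle disappear, and every other edge of $H$ is kept (so parallel edges may arise and are retained). A cubic multigraph is a multigraph in which every vertex has degree $3$ (counting edges with multiplicity). The truncation $T(G)$ of a loopless cubic multigraph $G$ is the graph obtained by replacing each vertex of $G$ by a triangle, with one corner per incident edge: its vertices are the pairs $(v,e)$ with $e$ an edge of $G$ incident to $v$; $(v,e)$ and $(v,f)$ are adjacent for $e\neq f$, and for each edge $e$ of $G$ with endpoints $v\ne w$, the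 vertices $(v,e)$ and $(w,e)$ are adjacent. Equality $H=T(M)$ is up to graph isomorphism. *)

theory Defs
  imports "HOL-Library.Multiset"
begin

text \<open>Undirected multigraphs: edges are named objects, and the ends of an edge form a
  two-element set of vertices, or a singleton if the edge is a loop.\<close>

record ('v, 'e) multigraph =
  verts :: "'v set"
  edges :: "'e set"
  ends :: "'e \<Rightarrow> 'v set"

definition wf_multigraph :: "('v, 'e) multigraph \<Rightarrow> bool" where
  "wf_multigraph G \<longleftrightarrow> finite (verts G) \<and> finite (edges G) \<and>
     (\<forall>e\<in>edges G. ends G e \<subseteq> verts G \<and> card (ends G e) \<in> {1, 2})"

definition loopless :: "('v, 'e) multigraph \<Rightarrow> bool" where
  "loopless G \<longleftrightarrow> (\<forall>e\<in>edges G. card (ends G e) = 2)"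

text \<open>A loop counts twice.\<close>

definition degree :: "('v, 'e) multigraph \<Rightarrow> 'v \<Rightarrow> nat" where
  "degree G v = card {e \<in> edges G. v \<in> ends G e} + card {e \<in> edges G. ends G e = {v}}"

definition cubic :: "('v, 'e) multigraph \<Rightarrow> bool" where
  "cubic G \<longleftrightarrow> (\<forall>v\<in>verts G. degree G v = 3)"

definition isomorphic :: "('v, 'e) multigraph \<Rightarrow> ('w, 'f) multigraph \<Rightarrow> bool" where
  "isomorphic G G' \<longleftrightarrow> (\<exists>f g. bij_betw f (verts G) (verts G') \<and> bij_betw g (edges G) (edges G') \<and>
     (\<forall>e\<in>edges G. ends G' (g e) = f ` ends G e))"

text \<open>A simple graph is a multigraph whose edges are two-element vertex sets, each being its own
  set of ends.\<close>

type_synonym 'v graph = "('v, 'v set) multigraph"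

definition simple_graph :: "'v set \<Rightarrow> 'v set set \<Rightarrow> 'v graph" where
  "simple_graph V E = \<lparr>verts = V, edges = E, ends = (\<lambda>e. e)\<rparr>"

definition triangles :: "('v, 'e) multigraph \<Rightarrow> 'v set set" where
  "triangles G = {X. X \<subseteq> verts G \<and> card X = 3 \<and>
     (\<forall>x\<in>X. \<forall>y\<in>X. x \<noteq> y \<longrightarrow> (\<exists>e\<in>edges G. ends G e = {x, y}))}"

text \<open>Contraction of a family \<open>\<X>\<close> of pairwise disjoint vertex sets. A vertex of the contracted
  graph is the set of old vertices merged into it: the member of \<open>\<X>\<close> containing \<open>v\<close>, or \<open>{v}\<close> if
  there is none. Edges inside a member of \<open>\<X>\<close> disappear (for a triangle of a simple graph, these
  are exactly its three edges); all other edges survive as separate edges, so parallel edges are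
  retained.\<close>

definition merged :: "'v set set \<Rightarrow> 'v \<Rightarrow> 'v set" where
  "merged \<X> v = insert v (\<Union>{X \<in> \<X>. v \<in> X})"

definition contract :: "('v, 'e) multigraph \<Rightarrow> 'v set set \<Rightarrow> ('v set, 'e) multigraph" where
  "contract G \<X> = \<lparr>verts = merged \<X> ` verts G,
     edges = {e \<in> edges G. \<not> (\<exists>X\<in>\<X>. ends G e \<subseteq> X)},
     ends = (\<lambda>e. merged \<X> ` ends G e)\<rparr>"

definition truncation :: "('v, 'e) multigraph \<Rightarrow> ('v \<times> 'e) graph" where
  "truncation G = simple_graph
     {(v, e). v \<in> verts G \<and> e \<in> edges G \<and> v \<in> ends G e}
     ({{(v, e), (v, f)} | v e f. v \<in> verts G \<and> e \<in> edges G \<and> f \<in> edges G \<and>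
          v \<in> ends G e \<and> v \<in> ends G f \<and> e \<noteq> f} \<union>
      {{(v, e), (w, e)} | v w e. e \<in> edges G \<and> ends G e = {v, w} \<and> v \<noteq> w})"

datatype qvert = a0 | a1 | a2 | b0 | b1 | b2 | c0 | c1 | c2

definition Q :: "qvert graph" where
  "Q = simple_graph {a0, a1, a2, b0, b1, b2, c0, c1, c2}
     {{a0, a1}, {a1, a2}, {a0, a2},
      {b0, b1}, {b1, b2}, {b0, b2},
      {c0, c1}, {c1, c2}, {c0, c2},
      {a0, b0}, {a1, c0}, {b1, c1}, {b2, c2}}"

text \<open>The vertex \<open>(i, x)\<close> is the copy of \<open>x\<close> in the \<open>i\<close>-th copy of \<open>Q\<close>.\<close>

definition H :: "(nat \<times> qvert) graph" where
  "H = simple_graph ({1, 2} \<times> verts Q)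
     ((\<Union>i\<in>{1, 2}. (\<lambda>e. Pair i ` e) ` edges Q) \<union> {{(1, a2), (2, a2)}})"

text \<open>Contracted triangles, as vertices of the contraction.\<close>

definition vA :: "nat \<Rightarrow> (nat \<times> qvert) set" where
  "vA i = Pair i ` {a0, a1, a2}"

definition vB :: "nat \<Rightarrow> (nat \<times> qvert) set" where
  "vB i = Pair i ` {b0, b1, b2}"

definition vC :: "nat \<Rightarrow> (nat \<times> qvert) set" where
  "vC i = Pair i ` {c0, c1, c2}"

end

theory Submission
  imports Defs "HOL-Library.Disjoint_Sets"
begin

text \<open>
  The graph \<^const>\<open>H\<close> is a disjoint union of six triangles together with nine further edges, and
  these nine edges form a perfect matching none of whose edges lies inside a triangle. This
  structure alone, and not the particular graph, is behind everything except the explicit lists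
  of vertices and edges, so the proof is carried out for an arbitrary disjoint union of complete
  graphs (the \<^emph>\<open>blocks\<close>) plus a perfect matching between blocks.

  A vertex \<open>v\<close> of such a graph is determined by the pair of the block and the matching edge that
  contain it, since a matching edge meets a block in at most one vertex. After contraction of the
  blocks, the vertices are the blocks and the edges are the matching edges, and the block \<open>X\<close> is an
  end of the edge \<open>e\<close> exactly when \<open>X\<close> and \<open>e\<close> share a vertex. Hence the pairs coming from vertices
  are exactly the corners of the truncation of the contraction. Two vertices of one block
  correspond to two corners at one vertex, and a matching edge corresponds to the two corners on one edge, so
  the correspondence is a graph isomorphism (\<open>isomorphic_truncation_contraction\<close>). The same
  description shows that the degree of a contracted block is its size
  (\<open>degree_contraction\<close>).

  A triangle cannot use a matching edge \<open>xy\<close>: its third vertex lies outside the block of \<open>x\<close> or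
  outside that of \<open>y\<close>, so \<open>x\<close> or \<open>y\<close> would be on two matching edges. Therefore, if all
  blocks have three vertices, the triangles are exactly the blocks (\<open>triangles_eq_blocks\<close>).
\<close>

section \<open>Members of a partition\<close>

lemma merged_eq:
  assumes "partition_on V P" "X \<in> P" "v \<in> X"
  shows "merged P v = X"
proof -
  have "{Y \<in> P. v \<in> Y} = {X}"
    using assms by (auto simp: partition_on_def disjoint_def)
  then show ?thesis
    using assms(3) by (auto simp: merged_def)
qed

lemma merged_mem:
  assumes "partition_on V P" "v \<in> V"
  shows "merged P v \<in> P" "v \<in> merged P v"
proof -
  obtain X where "X \<in> P" "v \<in> X"
    using assms by (auto simp: partition_on_def)
  with merged_eq[OF assms(1)] show "merged P v \<in> P" "v \<in> merged P v"
    by auto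
qed

section \<open>Disjoint complete graphs joined by a perfect matching\<close>

text \<open>A perfect matching is a partition of the vertex set into pairs. Treating the blocks and the
  matching as two partitions of the same set makes \<^const>\<open>merged\<close> serve for both: it maps a
  vertex to its block and to its matching edge.\<close>

locale matched_cliques =
  fixes V :: "'v set" and P F :: "'v set set"
  assumes finite_V: "finite V"
    and blocks: "partition_on V P"
    and matching: "partition_on V F"
    and card_matching: "e \<in> F \<Longrightarrow> card e = 2"
    and matching_not_inside: "e \<in> F \<Longrightarrow> X \<in> P \<Longrightarrow> \<not> e \<subseteq> X"
begin

definition graph :: "'v graph" where
  "graph = simple_graph V (F \<union> {{x, y} | x y X. X \<in> P \<and> x \<in> X \<and> y \<in> X \<and> x \<noteq> y})"

abbreviation contraction :: "('v set, 'v set) multigraph" where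
  "contraction \<equiv> contract graph P"

abbreviation corner :: "'v \<Rightarrow> 'v set \<times> 'v set" where
  "corner v \<equiv> (merged P v, merged F v)"

lemma block_subset: "X \<in> P \<Longrightarrow> X \<subseteq> V"
  using blocks by (auto simp: partition_on_def)

lemma matching_subset: "e \<in> F \<Longrightarrow> e \<subseteq> V"
  using matching by (auto simp: partition_on_def)

lemma matching_edgeE:
  assumes "e \<in> F"
  obtains x y where "e = {x, y}" "x \<in> V" "y \<in> V" "merged P x \<noteq> merged P y"
proof -
  obtain x y where e: "e = {x, y}"
    using card_matching[OF assms] by (auto simp: card_2_iff)
  have V: "x \<in> V" "y \<in> V"
    using matching_subset[OF assms] e by auto
  moreover have "merged P x \<noteq> merged P y"
    using matching_not_inside[OF assms, of "merged P x"] merged_mem[OF blocks] V e by auto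
  ultimately show ?thesis
    using that e by blast
qed

lemma block_matching_meet:
  assumes "X \<in> P" "e \<in> F" "v \<in> X" "w \<in> X" "v \<in> e" "w \<in> e"
  shows "v = w"
  using assms(2)
proof (cases rule: matching_edgeE)
  case (1 x y)
  then show ?thesis
    using assms merged_eq[OF blocks assms(1)] by auto
qed

lemma contraction_simps:
  "verts contraction = P"
  "edges contraction = F"
  "ends contraction e = merged P ` e"
proof -
  have "merged P ` V = P"
  proof (intro equalityI subsetI)
    fix X assume "X \<in> merged P ` V"
    then show "X \<in> P"
      using merged_mem(1)[OF blocks] by auto
  next
    fix X assume X: "X \<in> P"
    then have "X \<noteq> {}"
      using partition_onD3[OF blocks] by auto
    then obtain v where "v \<in> X"
      by blast
    then have "v \<in> V" "X = merged P v"
      using merged_eq[OF blocks X] block_subset[OF X] by auto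
    then show "X \<in> merged P ` V"
      by (rule rev_image_eqI)
  qed
  then show "verts contraction = P"
    by (simp add: contract_def graph_def simple_graph_def)
  show "edges contraction = F"
  proof -
    define B where "B = {{x, y} | x y X. X \<in> P \<and> x \<in> X \<and> y \<in> X \<and> x \<noteq> y}"
    have "edges contraction = {e \<in> F \<union> B. \<not> (\<exists>X\<in>P. e \<subseteq> X)}"
      by (simp add: contract_def graph_def simple_graph_def B_def)
    moreover have "\<forall>e\<in>B. \<exists>X\<in>P. e \<subseteq> X"
      by (auto simp: B_def)
    moreover have "\<forall>e\<in>F. \<not> (\<exists>X\<in>P. e \<subseteq> X)"
      using matching_not_inside by auto
    ultimately show ?thesis
      by (simp only: set_eq_iff mem_Collect_eq Un_iff) metis
  qed
  show "ends contraction e = merged P ` e"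
    by (simp add: contract_def graph_def simple_graph_def)
qed

text \<open>This description of incidence is what turns the vertices inside a block into the corners at
  the contracted block.\<close>

lemma mem_ends_contraction:
  assumes "X \<in> P" "e \<in> F"
  shows "X \<in> ends contraction e \<longleftrightarrow> (\<exists>v. v \<in> X \<and> v \<in> e)"
proof -
  have "X = merged P v \<longleftrightarrow> v \<in> X" if "v \<in> e" for v
    using merged_eq[OF blocks assms(1)] merged_mem(2)[OF blocks, of v]
      matching_subset[OF assms(2)] that by auto
  then show ?thesis
    unfolding contraction_simps by auto
qed

lemma card_ends_contraction:
  assumes "e \<in> F"
  shows "card (ends contraction e) = 2"
  using assms by (cases rule: matching_edgeE) (auto simp: contraction_simps)

lemma loopless_contraction: "loopless contraction"
  by (simp add: loopless_def contraction_simps(2) card_ends_contraction)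

lemma wf_contraction: "wf_multigraph contraction"
proof -
  have "merged P ` e \<subseteq> P" if "e \<in> F" for e
    using merged_mem[OF blocks] matching_subset[OF that] by auto
  moreover have "finite P" "finite F"
    using finite_elements[OF finite_V] blocks matching by auto
  ultimately show ?thesis
    using card_ends_contraction by (auto simp: wf_multigraph_def contraction_simps)
qed

text \<open>Each vertex of a block is on one matching edge, and different vertices of the block are on
  different ones, because no matching edge lies inside the block.\<close>

lemma degree_contraction:
  assumes X: "X \<in> P"
  shows "degree contraction X = card X"
proof -
  have "bij_betw (merged F) X {e \<in> F. X \<in> ends contraction e}"
  proof (rule bij_betwI')
    fix v w assume "v \<in> X" "w \<in> X"
    then show "merged F v = merged F w \<longleftrightarrow> v = w"
      using block_matching_meet[OF X] merged_mem[OF matching] block_subset[OF X] by (metis subsetD)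
  next
    fix v assume "v \<in> X"
    then show "merged F v \<in> {e \<in> F. X \<in> ends contraction e}"
      using mem_ends_contraction[OF X] merged_mem[OF matching] block_subset[OF X] by blast
  next
    fix e assume "e \<in> {e \<in> F. X \<in> ends contraction e}"
    then obtain v where "e \<in> F" "v \<in> X" "v \<in> e"
      using mem_ends_contraction[OF X] by blast
    then show "\<exists>v\<in>X. e = merged F v"
      using merged_eq[OF matching] by metis
  qed
  moreover have "{e \<in> F. ends contraction e = {X}} = {}"
    using card_ends_contraction by fastforce
  ultimately show ?thesis
    unfolding degree_def contraction_simps(2) by (simp add: bij_betw_same_card del: Collect_empty_eq)
qed

lemma verts_truncation_contraction:
  "verts (truncation contraction) = {(X, e). X \<in> P \<and> e \<in> F \<and> (\<exists>v. v \<in> X \<and> v \<in> e)}"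
  using mem_ends_contraction
  by (auto simp: truncation_def simple_graph_def contraction_simps(1,2))

text \<open>Injectivity is the fact that a block and a matching edge share at most one vertex;
  surjectivity holds because a block that is an end of a matching edge shares a vertex with it.\<close>

lemma bij_corner: "bij_betw corner V (verts (truncation contraction))"
proof (rule bij_betwI')
  fix v w assume "v \<in> V" "w \<in> V"
  then show "corner v = corner w \<longleftrightarrow> v = w"
    using block_matching_meet merged_mem[OF blocks] merged_mem[OF matching] by (metis prod.inject)
next
  fix v assume "v \<in> V"
  then show "corner v \<in> verts (truncation contraction)"
    using merged_mem[OF blocks, of v] merged_mem[OF matching, of v]
    by (auto simp: verts_truncation_contraction)
next
  fix c assume "c \<in> verts (truncation contraction)"
  then obtain X e v where c: "c = (X, e)" "X \<in> P" "e \<in> F" "v \<in> X" "v \<in> e"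
    by (auto simp: verts_truncation_contraction)
  then have "v \<in> V" "c = corner v"
    using merged_eq[OF blocks c(2,4)] merged_eq[OF matching c(3,5)] block_subset by auto
  then show "\<exists>v\<in>V. c = corner v"
    by (rule bexI[rotated])
qed

text \<open>The truncation joins two corners if they lie at one contracted block or on one matching edge;
  under \<open>corner\<close>, these correspond to the pairs inside a block and the matching edges.\<close>

lemma edges_truncation_contraction:
  "edges (truncation contraction) =
     {corner ` {x, y} | x y X. X \<in> P \<and> x \<in> X \<and> y \<in> X \<and> x \<noteq> y} \<union> (\<lambda>e. corner ` e) ` F"
  (is "_ = ?B \<union> ?M")
proof -
  let ?B' = "{{(X, e), (X, f)} | X e f. X \<in> P \<and> e \<in> F \<and> f \<in> F \<and>
    X \<in> ends contraction e \<and> X \<in> ends contraction f \<and> e \<noteq> f}"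
  let ?M' = "{{(X, e), (Y, e)} | X Y e. e \<in> F \<and> ends contraction e = {X, Y} \<and> X \<noteq> Y}"
  have "?B' = ?B"
  proof (intro equalityI subsetI)
    fix d assume "d \<in> ?B'"
    then obtain X e f where d: "d = {(X, e), (X, f)}" "X \<in> P" "e \<in> F" "f \<in> F" "e \<noteq> f"
      "X \<in> ends contraction e" "X \<in> ends contraction f"
      by blast
    then obtain x y where xy: "x \<in> X" "x \<in> e" "y \<in> X" "y \<in> f"
      using mem_ends_contraction by blast
    have "merged P x = X" "merged P y = X" "merged F x = e" "merged F y = f"
      using d xy merged_eq[OF blocks] merged_eq[OF matching] by auto
    then have "d = corner ` {x, y}" "x \<noteq> y"
      using d by auto
    then show "d \<in> ?B"
      using d(2) xy(1,3) by (intro CollectI exI[of _ x] exI[of _ y] exI[of _ X] conjI)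
  next
    fix d assume "d \<in> ?B"
    then obtain X x y where d: "d = corner ` {x, y}" "X \<in> P" "x \<in> X" "y \<in> X" "x \<noteq> y"
      by (elim CollectE exE conjE)
    have V: "x \<in> V" "y \<in> V"
      using d block_subset by auto
    note F = merged_mem[OF matching V(1)] merged_mem[OF matching V(2)]
    have "d = {(X, merged F x), (X, merged F y)}"
      using d merged_eq[OF blocks] by auto
    moreover have "merged F x \<noteq> merged F y"
      using d F block_matching_meet by metis
    moreover have "X \<in> ends contraction (merged F x)" "X \<in> ends contraction (merged F y)"
      using d(2-4) F mem_ends_contraction by blast+
    ultimately show "d \<in> ?B'"
      using d(2) F(1,3)
      by (intro CollectI exI[of _ X] exI[of _ "merged F x"] exI[of _ "merged F y"] conjI)
  qed
  moreover have "?M' = ?M"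
  proof (intro equalityI subsetI)
    fix d assume "d \<in> ?M'"
    then obtain X Y e where d: "d = {(X, e), (Y, e)}" "e \<in> F" "ends contraction e = {X, Y}"
      by blast
    have "corner ` e = (\<lambda>X. (X, e)) ` ends contraction e"
      using merged_eq[OF matching d(2)] by (auto simp: contraction_simps image_iff)
    then have "d = corner ` e"
      using d(1,3) by simp
    then show "d \<in> ?M"
      using d(2) by (rule image_eqI)
  next
    fix d assume "d \<in> ?M"
    then obtain e where d: "d = corner ` e" "e \<in> F"
      by (elim imageE)
    from d(2) show "d \<in> ?M'"
    proof (cases rule: matching_edgeE)
      case (1 x y)
      then have "d = {(merged P x, e), (merged P y, e)}"
        using d merged_eq[OF matching d(2)] by auto
      moreover have "ends contraction e = {merged P x, merged P y}"
        using 1 by (simp add: contraction_simps)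
      ultimately show ?thesis
        using 1(4) d(2)
        by (intro CollectI exI[of _ "merged P x"] exI[of _ "merged P y"] exI[of _ e] conjI)
    qed
  qed
  ultimately show ?thesis
    by (simp add: truncation_def simple_graph_def contraction_simps(1,2))
qed

theorem isomorphic_truncation_contraction: "isomorphic graph (truncation contraction)"
proof -
  have image_pairs: "g ` {{x, y} | x y X. R x y X} = {g {x, y} | x y X. R x y X}"
    for g :: "'v set \<Rightarrow> ('v set \<times> 'v set) set" and R :: "'v \<Rightarrow> 'v \<Rightarrow> 'v set \<Rightarrow> bool"
    by (auto simp: image_iff)
  have edges_graph: "edges graph = F \<union> {{x, y} | x y X. X \<in> P \<and> x \<in> X \<and> y \<in> X \<and> x \<noteq> y}"
    by (simp add: graph_def simple_graph_def)
  have "edges (truncation contraction) = (\<lambda>e. corner ` e) ` edges graph"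
    unfolding edges_truncation_contraction edges_graph image_Un image_pairs by (rule Un_commute)
  moreover have "inj_on (\<lambda>e. corner ` e) (edges graph)"
  proof -
    have "edges graph \<subseteq> Pow V"
      unfolding edges_graph using matching_subset block_subset by auto
    with inj_on_image_Pow[OF bij_betw_imp_inj_on[OF bij_corner]] show ?thesis
      by (rule inj_on_subset)
  qed
  ultimately have "bij_betw (\<lambda>e. corner ` e) (edges graph) (edges (truncation contraction))"
    by (simp add: bij_betw_def)
  moreover have "bij_betw corner (verts graph) (verts (truncation contraction))"
    using bij_corner by (simp add: graph_def simple_graph_def)
  moreover have "ends (truncation contraction) d = d" "ends graph e = e" for d e
    by (simp_all add: truncation_def graph_def simple_graph_def)
  ultimately show ?thesis
    unfolding isomorphic_def by (intro exI[of _ corner] exI[of _ "\<lambda>e. corner ` e"]) simp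
qed

text \<open>If an edge \<open>xy\<close> of a triangle joined two blocks, it would be the matching edge of both \<open>x\<close>
  and \<open>y\<close>. The third vertex \<open>z\<close> is outside the block of \<open>x\<close> or outside the block of \<open>y\<close>, and then
  \<open>xz\<close> or \<open>yz\<close> is a second matching edge at a common vertex.\<close>

lemma triangles_eq_blocks:
  assumes card_block: "\<And>X. X \<in> P \<Longrightarrow> card X = 3"
  shows "triangles graph = P"
proof (intro equalityI subsetI)
  fix X assume "X \<in> P"
  moreover from this have "X \<subseteq> V"
    by (rule block_subset)
  ultimately show "X \<in> triangles graph"
    using card_block by (auto simp: triangles_def graph_def simple_graph_def)
next
  fix T assume T: "T \<in> triangles graph"
  have TV: "T \<subseteq> V" and T3: "card T = 3"
    using T by (auto simp: triangles_def graph_def simple_graph_def)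
  have adj: "{x, y} \<in> F" if "x \<in> T" "y \<in> T" "merged P x \<noteq> merged P y" for x y
  proof -
    have "x \<noteq> y"
      using that by auto
    then have "{x, y} \<in> F \<or> (\<exists>X\<in>P. x \<in> X \<and> y \<in> X)"
      using T that by (auto simp: triangles_def graph_def simple_graph_def doubleton_eq_iff)
    then show ?thesis
      using that merged_eq[OF blocks] by metis
  qed
  have same_partner: "y = z" if "{x, y} \<in> F" "{x, z} \<in> F" for x y z
  proof -
    have "{x, y} = {x, z}"
      using that merged_eq[OF matching] by (metis insertI1)
    then show ?thesis
      by (auto simp: doubleton_eq_iff)
  qed
  have same_block: "merged P x = merged P y" if xy: "x \<in> T" "y \<in> T" for x y
  proof (rule ccontr)
    assume neq: "merged P x \<noteq> merged P y"
    have "\<not> T \<subseteq> {x, y}"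
      using T3 card_mono[of "{x, y}" T] card_insert_le_m1[of 2 "{y}" x] by auto
    then obtain z where z: "z \<in> T" "z \<noteq> x" "z \<noteq> y"
      by blast
    \<comment> \<open>\<open>z\<close> shares a block with at most one of \<open>x\<close> and \<open>y\<close>; the other one gets a second partner.\<close>
    show False
    proof (cases "merged P x = merged P z")
      case True
      then have "{y, x} \<in> F" "{y, z} \<in> F"
        using adj xy z neq by metis+
      then show False
        using same_partner z by blast
    next
      case False
      then have "{x, y} \<in> F" "{x, z} \<in> F"
        using adj xy z neq by metis+
      then show False
        using same_partner z by blast
    qed
  qed
  obtain x where x: "x \<in> T"
    using T3 by fastforce
  let ?X = "merged P x"
  have X: "?X \<in> P"
    using merged_mem[OF blocks] x TV by blast
  have "T \<subseteq> ?X"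
    using same_block[OF _ x] merged_mem(2)[OF blocks] TV by blast
  moreover have "finite ?X"
    using card_block[OF X] card.infinite by fastforce
  ultimately have "T = ?X"
    using card_block[OF X] T3 by (simp add: card_subset_eq)
  then show "T \<in> P"
    using X by simp
qed

end

section \<open>Two copies of the graph Q\<close>

definition H_blocks :: "(nat \<times> qvert) set set" where
  "H_blocks = {vA 1, vB 1, vC 1, vA 2, vB 2, vC 2}"

definition H_matching :: "(nat \<times> qvert) set set" where
  "H_matching =
    {{(1, a0), (1, b0)}, {(1, a1), (1, c0)}, {(1, b1), (1, c1)}, {(1, b2), (1, c2)},
     {(2, a0), (2, b0)}, {(2, a1), (2, c0)}, {(2, b1), (2, c1)}, {(2, b2), (2, c2)},
     {(1, a2), (2, a2)}}"

lemma verts_H: "verts H = {1, 2} \<times> {a0, a1, a2, b0, b1, b2, c0, c1, c2}"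
  by (simp add: H_def Q_def simple_graph_def)

interpretation H: matched_cliques "verts H" H_blocks H_matching
proof
  show "finite (verts H)"
    by (simp add: verts_H)
  show "partition_on (verts H) H_blocks"
    unfolding partition_on_def
  proof (intro conjI)
    show "\<Union>H_blocks = verts H"
      unfolding verts_H H_blocks_def vA_def vB_def vC_def by auto
    show "disjoint H_blocks"
      unfolding disjoint_def H_blocks_def vA_def vB_def vC_def by simp
    show "{} \<notin> H_blocks"
      by (simp add: H_blocks_def vA_def vB_def vC_def)
  qed
  show "partition_on (verts H) H_matching"
    unfolding partition_on_def
  proof (intro conjI)
    show "\<Union>H_matching = verts H"
      unfolding verts_H H_matching_def by auto
    show "disjoint H_matching"
      unfolding disjoint_def H_matching_def by simp
    show "{} \<notin> H_matching"
      by (simp add: H_matching_def)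
  qed
  show "card e = 2" if "e \<in> H_matching" for e
    using that by (auto simp: H_matching_def)
  have "\<forall>e\<in>H_matching. \<forall>X\<in>H_blocks. \<not> e \<subseteq> X"
    unfolding H_matching_def H_blocks_def vA_def vB_def vC_def by simp
  then show "\<not> e \<subseteq> X" if "e \<in> H_matching" "X \<in> H_blocks" for e X
    using that by blast
qed

lemma pairs_in_triple:
  assumes "p \<noteq> q" "q \<noteq> r" "p \<noteq> r"
  shows "{{x, y} | x y. x \<in> {p, q, r} \<and> y \<in> {p, q, r} \<and> x \<noteq> y} = {{p, q}, {q, r}, {p, r}}"
    (is "?L = ?R")
proof
  show "?L \<subseteq> ?R"
    by (auto simp: insert_commute)
  show "?R \<subseteq> ?L"
    using assms by blast
qed

text \<open>The nine matching edges are the four connecting edges of each copy of \<^const>\<open>Q\<close> and the edge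
  between the copies; it remains to see that the pairs inside blocks are the 18 triangle edges.\<close>

lemma graph_eq_H: "H.graph = H"
proof -
  define pairs where "pairs X = {{x, y} | x y. x \<in> X \<and> y \<in> X \<and> x \<noteq> y}"
    for X :: "(nat \<times> qvert) set"
  have pairs: "pairs {p, q, r} = {{p, q}, {q, r}, {p, r}}"
    if "p \<noteq> q" "q \<noteq> r" "p \<noteq> r" for p q r
    unfolding pairs_def using that by (rule pairs_in_triple)
  have "{{x, y} | x y X. X \<in> H_blocks \<and> x \<in> X \<and> y \<in> X \<and> x \<noteq> y} =
      (\<Union>X\<in>H_blocks. pairs X)"
    unfolding pairs_def by blast
  also have "\<dots> = (\<Union>i\<in>{1, 2}.
      {{(i, a0), (i, a1)}, {(i, a1), (i, a2)}, {(i, a0), (i, a2)},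
       {(i, b0), (i, b1)}, {(i, b1), (i, b2)}, {(i, b0), (i, b2)},
       {(i, c0), (i, c1)}, {(i, c1), (i, c2)}, {(i, c0), (i, c2)}})"
    unfolding H_blocks_def vA_def vB_def vC_def by (simp add: pairs insert_commute)
  also have "H_matching \<union> \<dots> = edges H"
    unfolding H_def Q_def simple_graph_def H_matching_def by (simp add: insert_commute)
  finally show ?thesis
    unfolding H.graph_def by (simp add: H_def simple_graph_def)
qed

lemma card_H_blocks: "X \<in> H_blocks \<Longrightarrow> card X = 3"
  by (auto simp: H_blocks_def vA_def vB_def vC_def)

lemma merged_H_blocks:
  assumes "i \<in> {1, 2}"
  shows "merged H_blocks (i, a0) = vA i" "merged H_blocks (i, a1) = vA i"
    "merged H_blocks (i, a2) = vA i" "merged H_blocks (i, b0) = vB i"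
    "merged H_blocks (i, b1) = vB i" "merged H_blocks (i, b2) = vB i"
    "merged H_blocks (i, c0) = vC i" "merged H_blocks (i, c1) = vC i"
    "merged H_blocks (i, c2) = vC i"
  using assms
  by (auto intro!: merged_eq[OF H.blocks]) (auto simp: H_blocks_def vA_def vB_def vC_def)

lemma ends_H_matching:
  "image_mset (\<lambda>e. merged H_blocks ` e) (mset_set H_matching) =
      {# {vA 1, vB 1}, {vA 1, vC 1}, {vB 1, vC 1}, {vB 1, vC 1},
         {vA 2, vB 2}, {vA 2, vC 2}, {vB 2, vC 2}, {vB 2, vC 2},
         {vA 1, vA 2} #}"
proof -
  have *: "mset_set H_matching =
    {# {(1, a0), (1, b0)}, {(1, a1), (1, c0)}, {(1, b1), (1, c1)}, {(1, b2), (1, c2)},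
       {(2, a0), (2, b0)}, {(2, a1), (2, c0)}, {(2, b1), (2, c1)}, {(2, b2), (2, c2)},
       {(1, a2), (2, a2)} #}"
    unfolding H_matching_def by (simp add: doubleton_eq_iff)
  show ?thesis
    unfolding * by (simp add: merged_H_blocks)
qed

theorem proposition3:
  fixes M :: "((nat \<times> qvert) set, (nat \<times> qvert) set) multigraph"
  assumes "M = contract H (triangles H)"
  shows "triangles H = {vA 1, vB 1, vC 1, vA 2, vB 2, vC 2} \<and>
    wf_multigraph M \<and> loopless M \<and> cubic M \<and>
    verts M = {vA 1, vB 1, vC 1, vA 2, vB 2, vC 2} \<and>
    distinct [vA 1, vB 1, vC 1, vA 2, vB 2, vC 2] \<and>
    image_mset (ends M) (mset_set (edges M)) =
      {# {vA 1, vB 1}, {vA 1, vC 1}, {vB 1, vC 1}, {vB 1, vC 1},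
         {vA 2, vB 2}, {vA 2, vC 2}, {vB 2, vC 2}, {vB 2, vC 2},
         {vA 1, vA 2} #} \<and>
    isomorphic H (truncation M)"
proof -
  have tri: "triangles H = H_blocks"
    using H.triangles_eq_blocks[OF card_H_blocks] by (simp add: graph_eq_H)
  then have M: "M = H.contraction"
    using assms by (simp add: graph_eq_H)
  have "cubic M"
    unfolding cubic_def M H.contraction_simps(1)
    using H.degree_contraction card_H_blocks by simp
  moreover have "distinct [vA 1, vB 1, vC 1, vA 2, vB 2, vC 2]"
    by (simp add: vA_def vB_def vC_def set_eq_subset)
  moreover have "image_mset (ends M) (mset_set (edges M)) =
      {# {vA 1, vB 1}, {vA 1, vC 1}, {vB 1, vC 1}, {vB 1, vC 1},
         {vA 2, vB 2}, {vA 2, vC 2}, {vB 2, vC 2}, {vB 2, vC 2},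
         {vA 1, vA 2} #}"
    unfolding M H.contraction_simps(2,3) by (rule ends_H_matching)
  moreover have "isomorphic H (truncation M)"
    unfolding M using H.isomorphic_truncation_contraction by (simp only: graph_eq_H)
  moreover have "verts M = {vA 1, vB 1, vC 1, vA 2, vB 2, vC 2}"
    unfolding M H.contraction_simps(1) by (rule H_blocks_def)
  moreover have "triangles H = {vA 1, vB 1, vC 1, vA 2, vB 2, vC 2}"
    unfolding tri by (rule H_blocks_def)
  ultimately show ?thesis
    using H.wf_contraction H.loopless_contraction M by blast
qed

end
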